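(* Let $A,B>0$, $k\in\mathbb R\setminus\{0\}$, and let $\chi_0$ be a triple spatial root, $F(\chi;\mu_0)=\mu_0(\chi-\chi_0)^3$ (notation in context). Let $M_1,M_2\in\mathbb C$ with $M_2\ne0$ satisfy $$g_{11}|M_1|^2+g_{02}\operatorname{Re}M_2+\operatorname{Re}\left(g_{12}M_1^*M_2\right)+\frac{g_{22}}{4}|M_2|^2=0 .$$ Let $\Gamma_T=\{(x,t)\in\mathbb R^2:x+\frac{t}{3k^2}=0\}$. Then $$m_R^{(3)}\big|_{\Gamma_T}=d_Tt^2+O(|t|),\qquad |t|\to\infty .$$ With $\mathbf y_R=(\psi_R,\phi_R,\varphi_R)^{\mathsf T}$, $\Phi_{1,R}=\phi_R$, $\Phi_{2,R}=\varphi_R$, $$\frac{2\Phi_{j,R}\psi_R^*}{u_{j,0}}\Big|_{\Gamma_T}=2|c_T|^2\lambda_0h_j(\chi_0)t^2+O(|t|),\qquad j=1,2 .$$ Consequently $$\lim_{\substack{|t|\to\infty\\(x,t)\in\Gamma_T}}\frac{u_j^{(R,3;\mathrm i)}(x,t)}{u_{j,0}(x,t)}=\mathcal P_j^{(T)}:=1+\frac{2|c_T|^2\lambda_0h_j(\chi_0)}{d_T},\qquad j=1,2,$$ and $\mathcal P_j^{(T)}\neq1$ for $j=1,2$. Thus the modulation does not decay to the plane-wave background along $\Gamma_T$.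
   Context: $S=A+B$, $R=A-B$; $a_1,a_2\in\mathbb R$ with $a_1^2=A$, $a_2^2=B$; $k_1=k$, $k_2=-k$; $\omega_1=1/k-A$, $\omega_2=-1/k-B$; $u_{j,0}=a_j\exp[\mathrm i(k_jx+\omega_jt)]$ for $(x,t)\in\mathbb R^2$. $F(\chi;\mu)=\mu\chi^3-2\chi^2+k^2(S-\mu)\chi+k^2(2-kR)$. At a triple root automatically $\chi_0\in\mathbb R$, $0<\chi_0<|k|$, $\mu_0=\frac{2}{3\chi_0}>0$; $\lambda_0=\sqrt{\mu_0}>0$. $\nu(\chi)=\frac S2+\frac{2-kR}{2\chi}$, $\nu_\ell=\nu^{(\ell)}(\chi_0)$ (in particular $\nu_1=\frac1{3k^2}$), $E(\chi)=\exp[\mathrm i(\chi x+\nu(\chi)t)]$, $h_1(\chi)=\frac{k}{k+\chi}$, $h_2(\chi)=\frac{k}{k-\chi}$, $\mathbf y(\chi,\lambda)=(\lambda E(\chi),u_{1,0}h_1(\chi)E(\chi),u_{2,0}h_2(\chi)E(\chi))^{\mathsf T}$, $\mathbf Y_n=\partial_\chi^n\mathbf y(\chi,\lambda_0)|_{\chi=\chi_0}$ (fixed $\lambda_0$), $E_n=\partial_\chi^nE(\chi)|_{\chi=\chi_0}$. $J=\operatorname{diag}(1,-1,-1)$, $K=I_3$, $\langle\mathbf f|M|\mathbf g\rangle=\mathbf f^\dagger M\mathbf g$; $g_{mn}=\langle\mathbf Y_m|J|\mathbf Y_n\rangle$ ($0\le m,n\le2$), real constants independent of $(x,t)$; $^*$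 is complex conjugation. $D_0=\chi_0^3-k^2\chi_0$, $D_1=3\chi_0^2-k^2$, $\mathcal M_3=-\frac{3\chi_0M_2+D_1M_1+D_0}{\mu_0}$, $\mathcal M_4=-\frac{D_1M_2+D_0M_1}{\mu_0}$, $\mathcal M_5=-\frac{D_0M_2}{\mu_0}$. $$\mathbf y_R=\mathbf Y_0+M_1\mathbf Y_1+\tfrac{M_2}{2}\mathbf Y_2,\qquad \mathbf y_\mu=\tfrac1{2\lambda_0}\big(E_0+M_1E_1+\tfrac{M_2}{2}E_2,0,0\big)^{\mathsf T}+\tfrac{\mathcal M_3}{6}\mathbf Y_3+\tfrac{\mathcal M_4}{24}\mathbf Y_4+\tfrac{\mathcal M_5}{120}\mathbf Y_5,$$ $$m_R^{(3)}=\lambda_0\big(\langle\mathbf y_\mu|J|\mathbf y_R\rangle-\langle\mathbf y_R|J|\mathbf y_\mu\rangle\big)-\frac{\langle\mathbf y_R|K|\mathbf y_R\rangle}{2\lambda_0},\qquad u_j^{(R,3;\mathrm i)}=u_{j,0}+\frac{2\Phi_{j,R}\psi_R^*}{m_R^{(3)}}.$$ Constants: $\mathbf v_0=(\lambda_0,a_1h_1(\chi_0),a_2h_2(\chi_0))^{\mathsf T}$, $\mathbf v_n=(0,a_1h_1^{(n)}(\chi_0),a_2h_2^{(n)}(\chi_0))^{\mathsf T}$ for $n\ge1$; $c_T=\frac{\mathrm i\nu_2M_2}{2}$; $\mathbf r_T=\mathbf v_0+M_1\mathbf v_1+\frac{M_2}{2}\mathbf v_2$; $$\mathbf p_{T,2}=-\Big(\frac{\nu_2^2\mathcal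 M_4}{8}+\frac{\nu_2\nu_3\mathcal M_5}{12}\Big)\mathbf v_0-\frac{\nu_2^2\mathcal M_5}{8}\mathbf v_1,$$ $$\mathbf p_{T,1}=\frac{\mathrm i\nu_2M_2}{4\lambda_0}(1,0,0)^{\mathsf T}+\frac{\mathrm i\mathcal M_3}{6}(\nu_3\mathbf v_0+3\nu_2\mathbf v_1)+\frac{\mathrm i\mathcal M_4}{24}(\nu_4\mathbf v_0+4\nu_3\mathbf v_1+6\nu_2\mathbf v_2)+\frac{\mathrm i\mathcal M_5}{120}(\nu_5\mathbf v_0+5\nu_4\mathbf v_1+10\nu_3\mathbf v_2+10\nu_2\mathbf v_3);$$ $\zeta_{T,2}=c_T^*\langle\mathbf v_0|J|\mathbf p_{T,1}\rangle+\langle\mathbf r_T|J|\mathbf p_{T,2}\rangle$; $\kappa_0=\langle\mathbf v_0|K|\mathbf v_0\rangle$; $d_T=-\frac{|c_T|^2\kappa_0}{2\lambda_0}-2\mathrm i\lambda_0\operatorname{Im}\zeta_{T,2}$. *)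

theory Defs
  imports "HOL-Analysis.Analysis" "HOL-Library.Landau_Symbols"
begin

(* A locale without assumptions: it only bundles the parameters of the definitions below.
   Only a 1 and a 2 (and, below, only the indices j = 1 and j = 2) are meaningful.
   The spectral variable is complex, so that the root chi and the value mu are not
   restricted to be real beforehand; likewise the square root of mu is taken in the
   complex numbers, where csqrt extends sqrt from the nonnegative reals. *)
locale triple_data =
  fixes A B k :: real
    and a :: "nat \<Rightarrow> real"
    and \<chi>\<^sub>0 \<mu>\<^sub>0 M\<^sub>1 M\<^sub>2 :: complex
begin

definition S :: real where "S = A + B"

definition R :: real where "R = A - B"

definition wavenumber :: "nat \<Rightarrow> real" where
  "wavenumber j = (if j = 1 then k else - k)"

definition freq :: "nat \<Rightarrow> real" where
  "freq j = (if j = 1 then 1 / k - A else - (1 / k) - B)"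

definition u0 :: "nat \<Rightarrow> real \<Rightarrow> real \<Rightarrow> complex" where
  "u0 j x t = of_real (a j) * exp (\<i> * of_real (wavenumber j * x + freq j * t))"

definition F :: "complex \<Rightarrow> complex \<Rightarrow> complex" where
  "F z \<mu> = \<mu> * z ^ 3 - 2 * z\<^sup>2 + of_real (k\<^sup>2) * (of_real S - \<mu>) * z
             + of_real (k\<^sup>2 * (2 - k * R))"

definition lam\<^sub>0 :: complex where "lam\<^sub>0 = csqrt \<mu>\<^sub>0"

definition \<nu> :: "complex \<Rightarrow> complex" where
  "\<nu> z = of_real (S / 2) + of_real (2 - k * R) / (2 * z)"

definition \<nu>_d :: "nat \<Rightarrow> complex" where
  "\<nu>_d l = (deriv ^^ l) \<nu> \<chi>\<^sub>0"

definition E :: "real \<Rightarrow> real \<Rightarrow> complex \<Rightarrow> complex" where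
  "E x t z = exp (\<i> * (z * of_real x + \<nu> z * of_real t))"

definition E_d :: "real \<Rightarrow> real \<Rightarrow> nat \<Rightarrow> complex" where
  "E_d x t n = (deriv ^^ n) (E x t) \<chi>\<^sub>0"

definition h :: "nat \<Rightarrow> complex \<Rightarrow> complex" where
  "h j z = (if j = 1 then of_real k / (of_real k + z) else of_real k / (of_real k - z))"

definition h_d :: "nat \<Rightarrow> nat \<Rightarrow> complex" where
  "h_d j n = (deriv ^^ n) (h j) \<chi>\<^sub>0"

definition y :: "real \<Rightarrow> real \<Rightarrow> complex \<Rightarrow> complex \<Rightarrow> complex ^ 3" where
  "y x t z l = vector [l * E x t z, u0 1 x t * h 1 z * E x t z, u0 2 x t * h 2 z * E x t z]"

definition Y :: "real \<Rightarrow> real \<Rightarrow> nat \<Rightarrow> complex ^ 3" where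
  "Y x t n = (\<chi> i. (deriv ^^ n) (\<lambda>z. y x t z lam\<^sub>0 $ i) \<chi>\<^sub>0)"

definition J :: "complex ^ 3 ^ 3" where
  "J = (\<chi> i j. if i = j then (if i = 1 then 1 else - 1) else 0)"

definition K :: "complex ^ 3 ^ 3" where "K = mat 1"

definition bracket :: "complex ^ 3 \<Rightarrow> complex ^ 3 ^ 3 \<Rightarrow> complex ^ 3 \<Rightarrow> complex" where
  "bracket f M g = (\<Sum>i\<in>UNIV. cnj (f $ i) * (M *v g) $ i)"

(* At a triple root the Gram entries with indices at most 2 turn out to be real and
   independent of (x,t); as defined here they are functions of the point (x,t). *)
definition gram :: "real \<Rightarrow> real \<Rightarrow> nat \<Rightarrow> nat \<Rightarrow> complex" where
  "gram x t m n = bracket (Y x t m) J (Y x t n)"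

definition D\<^sub>0 :: complex where "D\<^sub>0 = \<chi>\<^sub>0 ^ 3 - of_real (k\<^sup>2) * \<chi>\<^sub>0"

definition D\<^sub>1 :: complex where "D\<^sub>1 = 3 * \<chi>\<^sub>0\<^sup>2 - of_real (k\<^sup>2)"

definition M\<^sub>3 :: complex where "M\<^sub>3 = - ((3 * \<chi>\<^sub>0 * M\<^sub>2 + D\<^sub>1 * M\<^sub>1 + D\<^sub>0) / \<mu>\<^sub>0)"

definition M\<^sub>4 :: complex where "M\<^sub>4 = - ((D\<^sub>1 * M\<^sub>2 + D\<^sub>0 * M\<^sub>1) / \<mu>\<^sub>0)"

definition M\<^sub>5 :: complex where "M\<^sub>5 = - ((D\<^sub>0 * M\<^sub>2) / \<mu>\<^sub>0)"

definition y_R :: "real \<Rightarrow> real \<Rightarrow> complex ^ 3" where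
  "y_R x t = Y x t 0 + M\<^sub>1 *s Y x t 1 + (M\<^sub>2 / 2) *s Y x t 2"

definition y_\<mu> :: "real \<Rightarrow> real \<Rightarrow> complex ^ 3" where
  "y_\<mu> x t = (1 / (2 * lam\<^sub>0)) *s vector [E_d x t 0 + M\<^sub>1 * E_d x t 1 + M\<^sub>2 / 2 * E_d x t 2, 0, 0]
     + (M\<^sub>3 / 6) *s Y x t 3 + (M\<^sub>4 / 24) *s Y x t 4 + (M\<^sub>5 / 120) *s Y x t 5"

definition m_R :: "real \<Rightarrow> real \<Rightarrow> complex" where
  "m_R x t = lam\<^sub>0 * (bracket (y_\<mu> x t) J (y_R x t) - bracket (y_R x t) J (y_\<mu> x t))
     - bracket (y_R x t) K (y_R x t) / (2 * lam\<^sub>0)"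

definition \<psi>_R :: "real \<Rightarrow> real \<Rightarrow> complex" where "\<psi>_R x t = y_R x t $ 1"

definition \<Phi>_R :: "nat \<Rightarrow> real \<Rightarrow> real \<Rightarrow> complex" where
  "\<Phi>_R j x t = (if j = 1 then y_R x t $ 2 else y_R x t $ 3)"

definition u_R :: "nat \<Rightarrow> real \<Rightarrow> real \<Rightarrow> complex" where
  "u_R j x t = u0 j x t + 2 * \<Phi>_R j x t * cnj (\<psi>_R x t) / m_R x t"

definition v :: "nat \<Rightarrow> complex ^ 3" where
  "v n = vector [if n = 0 then lam\<^sub>0 else 0, of_real (a 1) * h_d 1 n, of_real (a 2) * h_d 2 n]"

definition c_T :: complex where "c_T = \<i> * \<nu>_d 2 * M\<^sub>2 / 2"

definition r_T :: "complex ^ 3" where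
  "r_T = v 0 + M\<^sub>1 *s v 1 + (M\<^sub>2 / 2) *s v 2"

definition p_T2 :: "complex ^ 3" where
  "p_T2 = - ((\<nu>_d 2)\<^sup>2 * M\<^sub>4 / 8 + \<nu>_d 2 * \<nu>_d 3 * M\<^sub>5 / 12) *s v 0
     - ((\<nu>_d 2)\<^sup>2 * M\<^sub>5 / 8) *s v 1"

definition p_T1 :: "complex ^ 3" where
  "p_T1 = (\<i> * \<nu>_d 2 * M\<^sub>2 / (4 * lam\<^sub>0)) *s vector [1, 0, 0]
     + (\<i> * M\<^sub>3 / 6) *s (\<nu>_d 3 *s v 0 + (3 * \<nu>_d 2) *s v 1)
     + (\<i> * M\<^sub>4 / 24) *s (\<nu>_d 4 *s v 0 + (4 * \<nu>_d 3) *s v 1 + (6 * \<nu>_d 2) *s v 2)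
     + (\<i> * M\<^sub>5 / 120) *s (\<nu>_d 5 *s v 0 + (5 * \<nu>_d 4) *s v 1 + (10 * \<nu>_d 3) *s v 2
         + (10 * \<nu>_d 2) *s v 3)"

definition \<zeta>_T2 :: complex where
  "\<zeta>_T2 = cnj c_T * bracket (v 0) J p_T1 + bracket r_T J p_T2"

definition \<kappa>\<^sub>0 :: complex where "\<kappa>\<^sub>0 = bracket (v 0) K (v 0)"

definition d_T :: complex where
  "d_T = - (of_real ((cmod c_T)\<^sup>2) * \<kappa>\<^sub>0 / (2 * lam\<^sub>0)) - 2 * \<i> * lam\<^sub>0 * of_real (Im \<zeta>_T2)"

definition P_T :: "nat \<Rightarrow> complex" where
  "P_T j = 1 + 2 * of_real ((cmod c_T)\<^sup>2) * lam\<^sub>0 * h j \<chi>\<^sub>0 / d_T"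

definition \<Gamma>_T :: "(real \<times> real) set" where
  "\<Gamma>_T = {(x, t). x + t / (3 * k\<^sup>2) = 0}"

(* The filter for "(x,t) in Gamma_T and |t| tends to infinity". *)
definition along_\<Gamma>_T :: "(real \<times> real) filter" where
  "along_\<Gamma>_T = inf (filtercomap snd at_infinity) (principal \<Gamma>_T)"

end

end

theory Submission
  imports Defs "HOL-Complex_Analysis.Cauchy_Integral_Formula"
begin

text \<open>
  On \<open>\<Gamma>\<^sub>T\<close> the phase \<open>\<chi> x + \<nu>(\<chi>) t\<close> is stationary at \<open>\<chi>\<^sub>0\<close>, because \<open>\<nu>\<^sub>1 = 1 / (3 k\<^sup>2)\<close>. Hence the
  derivatives of \<open>E\<close> up to order five are \<open>E\<close> times polynomials in \<open>t\<close> of degree at most two, and up to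
  unimodular factors \<open>y\<^sub>R = r\<^sub>T + c\<^sub>T t v\<^sub>0\<close> and \<open>y\<^sub>\<mu> = p\<^sub>T\<^sub>2 t\<^sup>2 + p\<^sub>T\<^sub>1 t + p\<^sub>T\<^sub>0\<close>. The cubic term of
  \<open>m\<^sub>R\<close> is a multiple of the imaginary part of \<open>c\<^sub>T\<^sup>* \<langle>v\<^sub>0|J|p\<^sub>T\<^sub>2\<rangle>\<close>. It vanishes because \<open>p\<^sub>T\<^sub>2\<close> is a
  combination of \<open>v\<^sub>0\<close> and \<open>v\<^sub>1\<close>, while the triple root forces \<open>A = (k + \<chi>\<^sub>0)\<^sup>3 / (3 k\<^sup>3 \<chi>\<^sub>0)\<close> and
  \<open>B = (k - \<chi>\<^sub>0)\<^sup>3 / (3 k\<^sup>3 \<chi>\<^sub>0)\<close>, which makes \<open>v\<^sub>0\<close> isotropic and orthogonal to \<open>v\<^sub>1\<close>. Finally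
  \<open>Re d\<^sub>T = - |c\<^sub>T|\<^sup>2 \<kappa>\<^sub>0 / (2 \<lambda>\<^sub>0) < 0\<close>.
\<close>

text \<open>The Leibniz rule applied to \<open>exp (p w) * deriv p w\<close>, the first derivative
  of \<open>exp (p w)\<close>. The resulting recursion generates the Bell polynomials one order at a
  time.\<close>

lemma higher_deriv_exp_compose:
  fixes p :: "complex \<Rightarrow> complex"
  assumes "p holomorphic_on T" "open T" "z \<in> T"
  shows "(deriv ^^ Suc n) (\<lambda>w. exp (p w)) z =
    (\<Sum>i=0..n. of_nat (n choose i) * (deriv ^^ i) (\<lambda>w. exp (p w)) z * (deriv ^^ Suc (n - i)) p z)"
proof -
  have deriv_exp: "deriv (\<lambda>w. exp (p w)) w = exp (p w) * deriv p w" if "w \<in> T" for w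
    by (rule DERIV_imp_deriv)
      (use holomorphic_derivI[OF assms(1,2) that] in \<open>auto intro!: derivative_eq_intros\<close>)
  have hol: "(\<lambda>w. exp (p w)) holomorphic_on T" "deriv p holomorphic_on T"
    using assms by (auto intro!: holomorphic_intros)
  have "(deriv ^^ Suc n) (\<lambda>w. exp (p w)) z = (deriv ^^ n) (deriv (\<lambda>w. exp (p w))) z"
    by (simp add: funpow_Suc_right del: funpow.simps)
  \<comment> \<open>The product formula is known only on \<open>T\<close>; since \<open>T\<close> is
    open, this still determines the higher derivatives at \<open>z\<close>.\<close>
  also have "\<dots> = (deriv ^^ n) (\<lambda>w. exp (p w) * deriv p w) z"
    using assms hol deriv_exp
    by (intro higher_deriv_transform_within_open[of _ T]) (auto intro!: holomorphic_intros)
  also have "\<dots> = (\<Sum>i=0..n. of_nat (n choose i) * (deriv ^^ i) (\<lambda>w. exp (p w)) z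
      * (deriv ^^ (n - i)) (deriv p) z)"
    by (rule higher_deriv_mult[OF hol assms(2,3)])
  finally show ?thesis
    by (simp add: funpow_Suc_right del: funpow.simps)
qed

section \<open>Brackets and the splitting off of phases\<close>

context triple_data
begin

lemma bracket_J: "bracket f J g = cnj (f $ 1) * g $ 1 - cnj (f $ 2) * g $ 2 - cnj (f $ 3) * g $ 3"
  by (simp add: bracket_def J_def matrix_vector_mult_def sum_3)

lemma bracket_K: "bracket f K g = cnj (f $ 1) * g $ 1 + cnj (f $ 2) * g $ 2 + cnj (f $ 3) * g $ 3"
  by (simp add: bracket_def K_def sum_3)

text \<open>\<open>J\<close> is real and diagonal, hence Hermitian. This turns the difference of
  brackets in \<open>m_R\<close> into an imaginary part.\<close>

lemma cnj_bracket_J: "cnj (bracket f J g) = bracket g J f"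
  by (simp add: bracket_J mult.commute)

text \<open>The phase of \<open>u0\<close> without its amplitude, which stays in \<open>v\<close>.
  Component 1 has no seed wave; components 2 and 3 belong to \<open>j = 1\<close> and
  \<open>j = 2\<close>.\<close>

definition carrier_wave :: "real \<Rightarrow> real \<Rightarrow> 3 \<Rightarrow> complex" where
  "carrier_wave x t i = (if i = 1 then 1
     else exp (\<i> * of_real (wavenumber (if i = 2 then 1 else 2) * x
                             + freq (if i = 2 then 1 else 2) * t)))"

text \<open>For a real root this acts as a diagonal unitary matrix, invisible to brackets with the
  diagonal \<open>J\<close> and \<open>K\<close>.\<close>

definition dress :: "real \<Rightarrow> real \<Rightarrow> complex ^ 3 \<Rightarrow> complex ^ 3" where
  "dress x t f = (\<chi> i. carrier_wave x t i * E x t \<chi>\<^sub>0 * f $ i)"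

lemma dress_add: "dress x t (f + g) = dress x t f + dress x t g"
  by (simp add: dress_def vec_eq_iff algebra_simps)

lemma dress_scale: "dress x t (b *s f) = b *s dress x t f"
  by (simp add: dress_def vec_eq_iff algebra_simps)

lemma norm_carrier_wave: "cmod (carrier_wave x t i) = 1"
  by (simp add: carrier_wave_def)

end

section \<open>Algebraic consequences of the triple root\<close>

locale triple_root = triple_data +
  assumes A_pos: "A > 0" and B_pos: "B > 0" and k_nz: "k \<noteq> 0"
    and amplitude1: "(a 1)\<^sup>2 = A" and amplitude2: "(a 2)\<^sup>2 = B"
    and triple: "\<And>z. F z \<mu>\<^sub>0 = \<mu>\<^sub>0 * (z - \<chi>\<^sub>0) ^ 3"
    and M\<^sub>2_nz: "M\<^sub>2 \<noteq> 0"
begin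

text \<open>Comparison of coefficients. Both cubics have leading coefficient
  \<open>\<mu>\<^sub>0\<close>, so evaluation at 0, 1 and -1 captures the whole identity. The third
  relation has \<open>\<mu>\<^sub>0\<close> eliminated by means of the first.\<close>

lemma triple_coeffs:
  "3 * \<mu>\<^sub>0 * \<chi>\<^sub>0 = 2"
  "(of_real k)\<^sup>2 * (of_real S - \<mu>\<^sub>0) = 2 * \<chi>\<^sub>0"
  "3 * (of_real k)\<^sup>2 * (2 - of_real k * of_real R) = - 2 * \<chi>\<^sub>0\<^sup>2"
proof -
  have F0: "(of_real k)\<^sup>2 * (2 - of_real k * of_real R) = - \<mu>\<^sub>0 * \<chi>\<^sub>0 ^ 3"
    using triple[of 0] by (simp add: F_def power3_eq_cube)
  have F1: "\<mu>\<^sub>0 - 2 + (of_real k)\<^sup>2 * (of_real S - \<mu>\<^sub>0) - \<mu>\<^sub>0 * \<chi>\<^sub>0 ^ 3 = \<mu>\<^sub>0 * (1 - \<chi>\<^sub>0) ^ 3"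
    using triple[of 1] F0 by (simp add: F_def)
  have F2: "- \<mu>\<^sub>0 - 2 - (of_real k)\<^sup>2 * (of_real S - \<mu>\<^sub>0) - \<mu>\<^sub>0 * \<chi>\<^sub>0 ^ 3 = \<mu>\<^sub>0 * (- 1 - \<chi>\<^sub>0) ^ 3"
    using triple[of "- 1"] F0 by (simp add: F_def)
  show *: "3 * \<mu>\<^sub>0 * \<chi>\<^sub>0 = 2"
    using F1 F2 by algebra
  show "(of_real k)\<^sup>2 * (of_real S - \<mu>\<^sub>0) = 2 * \<chi>\<^sub>0"
    using F1 F2 * by algebra
  show "3 * (of_real k)\<^sup>2 * (2 - of_real k * of_real R) = - 2 * \<chi>\<^sub>0\<^sup>2"
    using F0 * by algebra
qed

lemma S_pos: "S > 0"
  using A_pos B_pos by (simp add: S_def)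

text \<open>Eliminating \<open>\<mu>\<^sub>0\<close> and then \<open>\<chi>\<^sub>0\<^sup>2\<close>
  leaves a linear equation for the root with real coefficients, whose leading one
  \<open>3 * k\<^sup>2 * S\<close> is nonzero.\<close>

lemma \<chi>\<^sub>0_real: "\<chi>\<^sub>0 = of_real (Re \<chi>\<^sub>0)"
proof -
  have "3 * (of_real k)\<^sup>2 * of_real S * \<chi>\<^sub>0
      = 3 * \<chi>\<^sub>0 * ((of_real k)\<^sup>2 * (of_real S - \<mu>\<^sub>0)) + (of_real k)\<^sup>2 * (3 * \<mu>\<^sub>0 * \<chi>\<^sub>0)"
    by algebra
  also have "\<dots> = 6 * \<chi>\<^sub>0\<^sup>2 + 2 * (of_real k)\<^sup>2"
    unfolding triple_coeffs(1,2) by algebra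
  also have "6 * \<chi>\<^sub>0\<^sup>2 = - 9 * ((of_real k)\<^sup>2 * (2 - of_real k * of_real R))"
    using triple_coeffs(3) by algebra
  finally have "3 * (of_real k)\<^sup>2 * of_real S * \<chi>\<^sub>0
      = - 9 * ((of_real k)\<^sup>2 * (2 - of_real k * of_real R)) + 2 * (of_real k)\<^sup>2" .
  then have "of_real (3 * k\<^sup>2 * S) * \<chi>\<^sub>0 = of_real (- 9 * (k\<^sup>2 * (2 - k * R)) + 2 * k\<^sup>2)"
    by simp
  then have "\<chi>\<^sub>0 = of_real (- 9 * (k\<^sup>2 * (2 - k * R)) + 2 * k\<^sup>2) / of_real (3 * k\<^sup>2 * S)"
    using S_pos k_nz by (simp add: eq_divide_eq mult.commute)
  then show ?thesis
    by (metis Re_complex_of_real of_real_divide)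
qed

lemma real_coeffs:
  "3 * Re \<mu>\<^sub>0 * Re \<chi>\<^sub>0 = 2"
  "\<mu>\<^sub>0 = of_real (Re \<mu>\<^sub>0)"
  "k\<^sup>2 * (S - Re \<mu>\<^sub>0) = 2 * Re \<chi>\<^sub>0"
  "3 * k\<^sup>2 * (2 - k * R) = - 2 * (Re \<chi>\<^sub>0)\<^sup>2"
proof -
  obtain X where X: "\<chi>\<^sub>0 = of_real X"
    using \<chi>\<^sub>0_real by blast
  have X_nz: "X \<noteq> 0"
    using triple_coeffs(1) X by auto
  have "\<mu>\<^sub>0 = of_real (2 / (3 * X))"
    using triple_coeffs(1) X X_nz by (simp add: field_simps)
  then obtain \<mu> where \<mu>: "\<mu>\<^sub>0 = of_real \<mu>"
    by blast
  then show "\<mu>\<^sub>0 = of_real (Re \<mu>\<^sub>0)"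
    by simp
  show "3 * Re \<mu>\<^sub>0 * Re \<chi>\<^sub>0 = 2"
    using arg_cong[OF triple_coeffs(1), of Re] by (simp add: \<mu> X)
  show "k\<^sup>2 * (S - Re \<mu>\<^sub>0) = 2 * Re \<chi>\<^sub>0"
    using arg_cong[OF triple_coeffs(2), of Re] by (simp add: \<mu> X flip: of_real_power)
  have "complex_of_real (3 * k\<^sup>2 * (2 - k * R)) = of_real (- 2 * X\<^sup>2)"
    using triple_coeffs(3) by (simp add: X)
  then show "3 * k\<^sup>2 * (2 - k * R) = - 2 * (Re \<chi>\<^sub>0)\<^sup>2"
    by (simp only: of_real_eq_iff X Re_complex_of_real)
qed

text \<open>Elimination of \<open>\<mu>\<^sub>0\<close>. The right-hand side is positive, so the
  root inherits the sign of \<open>S\<close>.\<close>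

lemma S_eq: "3 * k\<^sup>2 * S * Re \<chi>\<^sub>0 = 6 * (Re \<chi>\<^sub>0)\<^sup>2 + 2 * k\<^sup>2"
proof -
  have "3 * k\<^sup>2 * S * Re \<chi>\<^sub>0
      = 3 * Re \<chi>\<^sub>0 * (k\<^sup>2 * (S - Re \<mu>\<^sub>0)) + k\<^sup>2 * (3 * Re \<mu>\<^sub>0 * Re \<chi>\<^sub>0)"
    by algebra
  also have "\<dots> = 6 * (Re \<chi>\<^sub>0)\<^sup>2 + 2 * k\<^sup>2"
    unfolding real_coeffs(1,3) by algebra
  finally show ?thesis .
qed

lemma \<chi>\<^sub>0_pos: "Re \<chi>\<^sub>0 > 0"
proof -
  have "6 * (Re \<chi>\<^sub>0)\<^sup>2 + 2 * k\<^sup>2 > 0"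
    using k_nz by (simp add: add_nonneg_pos)
  then have "3 * k\<^sup>2 * S * Re \<chi>\<^sub>0 > 0"
    by (simp only: S_eq)
  then show ?thesis
    by (rule zero_less_mult_pos) (use S_pos k_nz in simp)
qed

lemma \<chi>\<^sub>0_nz: "\<chi>\<^sub>0 \<noteq> 0"
  using \<chi>\<^sub>0_pos by auto

text \<open>Put \<open>X = Re \<chi>\<^sub>0\<close>. The relation for \<open>A + B\<close> times
  \<open>k\<close> and that for \<open>A - B\<close> times \<open>X\<close> give twice the even and
  twice the odd part in \<open>X\<close> of \<open>(k + X) ^ 3\<close>; their sum and difference are
  the two cubes.\<close>

lemma amplitudes_cubed:
  "3 * k ^ 3 * Re \<chi>\<^sub>0 * A = (k + Re \<chi>\<^sub>0) ^ 3"
  "3 * k ^ 3 * Re \<chi>\<^sub>0 * B = (k - Re \<chi>\<^sub>0) ^ 3"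
proof -
  have "3 * k\<^sup>2 * (A + B) * Re \<chi>\<^sub>0 = 6 * (Re \<chi>\<^sub>0)\<^sup>2 + 2 * k\<^sup>2"
    using S_eq by (simp only: S_def)
  moreover have "3 * (k ^ 3 * (A - B)) = 6 * k\<^sup>2 + 2 * (Re \<chi>\<^sub>0)\<^sup>2"
    using real_coeffs(4) unfolding R_def by algebra
  ultimately have "2 * (3 * k ^ 3 * Re \<chi>\<^sub>0 * A) = 2 * (k + Re \<chi>\<^sub>0) ^ 3"
    "2 * (3 * k ^ 3 * Re \<chi>\<^sub>0 * B) = 2 * (k - Re \<chi>\<^sub>0) ^ 3"
    by algebra+
  then show "3 * k ^ 3 * Re \<chi>\<^sub>0 * A = (k + Re \<chi>\<^sub>0) ^ 3"
    "3 * k ^ 3 * Re \<chi>\<^sub>0 * B = (k - Re \<chi>\<^sub>0) ^ 3"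
    by linarith+
qed

text \<open>A vanishing factor would make a cube zero, against \<open>A > 0\<close> or
  \<open>B > 0\<close>.\<close>

lemma poles_avoided: "k + Re \<chi>\<^sub>0 \<noteq> 0" "k - Re \<chi>\<^sub>0 \<noteq> 0"
  using amplitudes_cubed A_pos B_pos k_nz \<chi>\<^sub>0_pos by auto

section \<open>Holomorphy of \<open>\<nu>\<close> and \<open>h\<close> away from their poles, and
  derivatives at the root\<close>

definition regular :: "complex set" where
  "regular = - {0, of_real k, - of_real k}"

lemma open_regular: "open regular"
  by (simp add: regular_def open_Compl)

lemma \<chi>\<^sub>0_regular: "\<chi>\<^sub>0 \<in> regular"
  using poles_avoided \<chi>\<^sub>0_nz by (auto simp: regular_def)

lemma regular_nz:
  assumes "z \<in> regular"
  shows "z \<noteq> 0" "of_real k + z \<noteq> 0" "of_real k - z \<noteq> 0"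
  using assms by (auto simp: regular_def add_eq_0_iff)

lemma \<nu>_holomorphic: "\<nu> holomorphic_on regular"
  unfolding \<nu>_def[abs_def] by (intro holomorphic_intros) (auto dest: regular_nz)

lemma h_holomorphic: "h j holomorphic_on regular"
  unfolding h_def[abs_def]
  by (cases "j = 1") (auto intro!: holomorphic_intros dest: regular_nz)

lemma deriv_\<nu>:
  assumes "z \<in> regular"
  shows "deriv \<nu> z = - of_real (2 - k * R) / (2 * z\<^sup>2)"
proof -
  have "((\<lambda>z. c + q / (2 * z)) has_field_derivative - q / (2 * z\<^sup>2)) (at z)" for c q
    using regular_nz[OF assms]
    by (auto intro!: derivative_eq_intros simp: field_simps power2_eq_square)
  then show ?thesis
    unfolding \<nu>_def[abs_def] by (rule DERIV_imp_deriv)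
qed

text \<open>At a triple root \<open>2 - k * R\<close> is a multiple of
  \<open>\<chi>\<^sub>0\<^sup>2\<close>, which cancels the denominator of the derivative. This value
  fixes the direction of \<open>\<Gamma>_T\<close>.\<close>

lemma \<nu>_d_1: "\<nu>_d 1 = 1 / (3 * of_real (k\<^sup>2))"
proof -
  have "\<nu>_d 1 = - of_real (2 - k * R) / (2 * \<chi>\<^sub>0\<^sup>2)"
    by (simp add: \<nu>_d_def deriv_\<nu>[OF \<chi>\<^sub>0_regular])
  also have "complex_of_real (2 - k * R) = - 2 * \<chi>\<^sub>0\<^sup>2 / (3 * (of_real k)\<^sup>2)"
  proof -
    have "complex_of_real (2 - k * R) * (3 * (of_real k)\<^sup>2) = - 2 * \<chi>\<^sub>0\<^sup>2"
      using triple_coeffs(3) by (simp add: mult_ac)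
    then show ?thesis
      using k_nz by (subst eq_divide_eq) simp
  qed
  also have "- (- 2 * \<chi>\<^sub>0\<^sup>2 / (3 * (of_real k)\<^sup>2)) / (2 * \<chi>\<^sub>0\<^sup>2) = 1 / (3 * of_real (k\<^sup>2))"
    using \<chi>\<^sub>0_nz by simp
  finally show ?thesis .
qed

text \<open>The second derivative is \<open>(2 - k * R) / \<chi>\<^sub>0 ^ 3\<close>, and
  \<open>2 - k * R\<close> is nonzero because \<open>\<chi>\<^sub>0\<close> is. Hence
  \<open>c_T\<close> is nonzero.\<close>

lemma \<nu>_d_2_nz: "\<nu>_d 2 \<noteq> 0"
proof -
  have q_nz: "complex_of_real (2 - k * R) \<noteq> 0"
    using triple_coeffs(3) \<chi>\<^sub>0_nz by auto
  have "\<nu>_d 2 = deriv (deriv \<nu>) \<chi>\<^sub>0"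
    by (simp add: \<nu>_d_def numeral_2_eq_2)
  also have "\<dots> = deriv (\<lambda>z. - of_real (2 - k * R) / (2 * z\<^sup>2)) \<chi>\<^sub>0"
    using eventually_nhds_in_open[OF open_regular \<chi>\<^sub>0_regular]
    by (intro deriv_cong_ev) (auto elim!: eventually_mono simp: deriv_\<nu>)
  also have "\<dots> = of_real (2 - k * R) / \<chi>\<^sub>0 ^ 3"
    by (rule DERIV_imp_deriv)
      (use \<chi>\<^sub>0_nz in \<open>auto intro!: derivative_eq_intros simp: field_simps power2_eq_square power3_eq_cube\<close>)
  finally show ?thesis
    using q_nz \<chi>\<^sub>0_nz by simp
qed

text \<open>Written as images of real numbers, so that the orthogonality relations become real field
  arithmetic.\<close>

lemma h_d_values:
  "h_d 1 0 = of_real (k / (k + Re \<chi>\<^sub>0))"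
  "h_d 2 0 = of_real (k / (k - Re \<chi>\<^sub>0))"
  "h_d 1 1 = of_real (- k / (k + Re \<chi>\<^sub>0)\<^sup>2)"
  "h_d 2 1 = of_real (k / (k - Re \<chi>\<^sub>0)\<^sup>2)"
proof -
  obtain X where X: "\<chi>\<^sub>0 = of_real X"
    using \<chi>\<^sub>0_real by blast
  note nz = regular_nz[OF \<chi>\<^sub>0_regular]
  show "h_d 1 0 = of_real (k / (k + Re \<chi>\<^sub>0))" "h_d 2 0 = of_real (k / (k - Re \<chi>\<^sub>0))"
    by (simp_all add: h_d_def h_def) (simp_all add: X)
  have "deriv (h 1) \<chi>\<^sub>0 = - of_real k / (of_real k + \<chi>\<^sub>0)\<^sup>2"
    unfolding h_def[abs_def] using nz
    by (auto intro!: DERIV_imp_deriv derivative_eq_intros simp: power2_eq_square)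
  then show "h_d 1 1 = of_real (- k / (k + Re \<chi>\<^sub>0)\<^sup>2)"
    by (simp add: h_d_def) (simp add: X)
  have "deriv (h 2) \<chi>\<^sub>0 = of_real k / (of_real k - \<chi>\<^sub>0)\<^sup>2"
    unfolding h_def[abs_def] using nz
    by (auto intro!: DERIV_imp_deriv derivative_eq_intros simp: power2_eq_square)
  then show "h_d 2 1 = of_real (k / (k - Re \<chi>\<^sub>0)\<^sup>2)"
    by (simp add: h_d_def) (simp add: X)
qed

lemma h_\<chi>\<^sub>0_nz: "h j \<chi>\<^sub>0 \<noteq> 0"
  using k_nz regular_nz[OF \<chi>\<^sub>0_regular] by (simp add: h_def)

section \<open>Positivity of \<open>lam\<^sub>0\<close> and the orthogonality relations\<close>

lemma lam\<^sub>0_real: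
  obtains l where "lam\<^sub>0 = of_real l" "l > 0" "3 * Re \<chi>\<^sub>0 * l\<^sup>2 = 2"
proof
  have "3 * Re \<mu>\<^sub>0 > 0"
    by (rule zero_less_mult_pos2[OF _ \<chi>\<^sub>0_pos]) (simp only: real_coeffs(1))
  then have \<mu>_pos: "Re \<mu>\<^sub>0 > 0"
    by simp
  then show "lam\<^sub>0 = of_real (sqrt (Re \<mu>\<^sub>0))"
    unfolding lam\<^sub>0_def by (subst real_coeffs(2)) (simp add: csqrt_of_real)
  show "sqrt (Re \<mu>\<^sub>0) > 0" "3 * Re \<chi>\<^sub>0 * (sqrt (Re \<mu>\<^sub>0))\<^sup>2 = 2"
    using \<mu>_pos real_coeffs(1) by (auto simp: algebra_simps)
qed

lemma v_components [simp]:
  "v 0 $ 1 = lam\<^sub>0" "n \<noteq> 0 \<Longrightarrow> v n $ 1 = 0"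
  "v n $ 2 = of_real (a 1) * h_d 1 n" "v n $ 3 = of_real (a 2) * h_d 2 n"
  by (simp_all add: v_def)

text \<open>The cubes in the squared amplitudes cancel the denominators of \<open>h\<close>. The
  first bracket becomes \<open>2/(3X) - (k+X)/(3kX) - (k-X)/(3kX)\<close>; in the second, both
  remaining terms equal \<open>1/(3kX)\<close> with opposite signs.\<close>

lemma v_orthogonal: "bracket (v 0) J (v 0) = 0" "bracket (v 0) J (v 1) = 0"
proof -
  define X where "X = Re \<chi>\<^sub>0"
  obtain l where l: "lam\<^sub>0 = of_real l" "l > 0" "3 * X * l\<^sup>2 = 2"
    using lam\<^sub>0_real X_def by metis
  have nz: "X \<noteq> 0" "k + X \<noteq> 0" "k - X \<noteq> 0"
    using \<chi>\<^sub>0_pos poles_avoided by (auto simp: X_def)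
  have l2: "l\<^sup>2 = 2 / (3 * X)"
    using l(3) nz by (simp add: field_simps)
  have a1: "(a 1)\<^sup>2 = (k + X) ^ 3 / (3 * k ^ 3 * X)"
    using amplitudes_cubed(1) amplitude1 nz k_nz by (simp add: X_def field_simps)
  have a2: "(a 2)\<^sup>2 = (k - X) ^ 3 / (3 * k ^ 3 * X)"
    using amplitudes_cubed(2) amplitude2 nz k_nz by (simp add: X_def field_simps)
  have "bracket (v 0) J (v 0) =
      of_real (l\<^sup>2 - (a 1)\<^sup>2 * (k / (k + X))\<^sup>2 - (a 2)\<^sup>2 * (k / (k - X))\<^sup>2)"
    unfolding bracket_J v_components h_d_values l(1) X_def by (simp add: power2_eq_square mult_ac)
  also have "l\<^sup>2 - (a 1)\<^sup>2 * (k / (k + X))\<^sup>2 - (a 2)\<^sup>2 * (k / (k - X))\<^sup>2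
      = 2 / (3 * X) - (k + X) / (3 * k * X) - (k - X) / (3 * k * X)"
    unfolding l2 a1 a2 using nz k_nz by (simp add: power2_eq_square power3_eq_cube)
  also have "\<dots> = 0"
    using nz k_nz by (simp add: field_simps)
  finally show "bracket (v 0) J (v 0) = 0"
    by simp
  have "bracket (v 0) J (v 1) =
      of_real ((a 1)\<^sup>2 * (k / (k + X)) * (k / (k + X)\<^sup>2) - (a 2)\<^sup>2 * (k / (k - X)) * (k / (k - X)\<^sup>2))"
    unfolding bracket_J v_components h_d_values
    by (simp add: h_d_values[unfolded One_nat_def] X_def power2_eq_square mult_ac)
  also have "(a 1)\<^sup>2 * (k / (k + X)) * (k / (k + X)\<^sup>2) - (a 2)\<^sup>2 * (k / (k - X)) * (k / (k - X)\<^sup>2) = 0"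
    unfolding a1 a2 using nz k_nz by (simp add: power2_eq_square power3_eq_cube)
  finally show "bracket (v 0) J (v 1) = 0"
    by simp
qed

section \<open>Invariance of the brackets under dressing\<close>

lemma norm_E: "cmod (E x t \<chi>\<^sub>0) = 1"
proof -
  obtain X where X: "\<chi>\<^sub>0 = of_real X"
    using \<chi>\<^sub>0_real by blast
  have "\<i> * (\<chi>\<^sub>0 * of_real x + \<nu> \<chi>\<^sub>0 * of_real t)
      = \<i> * of_real (X * x + (S / 2 + (2 - k * R) / (2 * X)) * t)"
    by (simp add: \<nu>_def X)
  then show ?thesis
    by (simp only: E_def norm_exp_i_times)
qed

text \<open>Each component is multiplied by a number of modulus 1, which meets its own
  conjugate.\<close>

lemma cnj_dress_mult: "cnj (dress x t f $ i) * dress x t g $ i = cnj (f $ i) * g $ i"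
proof -
  have "cnj (carrier_wave x t i * E x t \<chi>\<^sub>0) * (carrier_wave x t i * E x t \<chi>\<^sub>0) = 1"
    using complex_norm_square[of "carrier_wave x t i * E x t \<chi>\<^sub>0"]
    by (simp add: norm_mult norm_E norm_carrier_wave mult_ac)
  then show ?thesis
    by (simp add: dress_def) (metis (no_types, opaque_lifting) mult.assoc mult.left_commute mult_1)
qed

lemma bracket_dress:
  "bracket (dress x t f) J (dress x t g) = bracket f J g"
  "bracket (dress x t f) K (dress x t g) = bracket f K g"
  by (simp_all only: bracket_J bracket_K cnj_dress_mult)

section \<open>Derivatives of \<open>E\<close> and \<open>Y\<close> on
  \<open>\<Gamma>_T\<close>\<close>

lemma E_phase_holomorphic: "(\<lambda>z. \<i> * (z * of_real x + \<nu> z * of_real t)) holomorphic_on regular"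
  using \<nu>_holomorphic by (intro holomorphic_intros)

lemma E_holomorphic: "E x t holomorphic_on regular"
  unfolding E_def[abs_def] using \<nu>_holomorphic by (intro holomorphic_intros)

text \<open>\<open>x\<close> multiplies a linear function of the spectral variable, so it survives
  only in the first derivative.\<close>

lemma E_phase_deriv:
  "(deriv ^^ Suc n) (\<lambda>z. \<i> * (z * of_real x + \<nu> z * of_real t)) \<chi>\<^sub>0
    = \<i> * ((if n = 0 then of_real x else 0) + \<nu>_d (Suc n) * of_real t)"
proof -
  have "(\<lambda>z. \<i> * (z * of_real x + \<nu> z * of_real t))
      = (\<lambda>z. (\<i> * of_real x) * z + (\<i> * of_real t) * \<nu> z)"
    by (simp add: algebra_simps)
  then have "(deriv ^^ Suc n) (\<lambda>z. \<i> * (z * of_real x + \<nu> z * of_real t)) \<chi>\<^sub>0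
      = (deriv ^^ Suc n) (\<lambda>z. (\<i> * of_real x) * z + (\<i> * of_real t) * \<nu> z) \<chi>\<^sub>0"
    by simp
  also have "\<dots> = (deriv ^^ Suc n) (\<lambda>z. (\<i> * of_real x) * z) \<chi>\<^sub>0
      + (deriv ^^ Suc n) (\<lambda>z. (\<i> * of_real t) * \<nu> z) \<chi>\<^sub>0"
    using \<nu>_holomorphic open_regular \<chi>\<^sub>0_regular
    by (intro higher_deriv_add[where S = regular]) (auto intro!: holomorphic_intros)
  also have "(deriv ^^ Suc n) (\<lambda>z. (\<i> * of_real t) * \<nu> z) \<chi>\<^sub>0
      = (\<i> * of_real t) * (deriv ^^ Suc n) \<nu> \<chi>\<^sub>0"
    by (rule higher_deriv_cmult[OF \<nu>_holomorphic \<chi>\<^sub>0_regular open_regular])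
  finally show ?thesis
    unfolding higher_deriv_linear \<nu>_d_def by (simp add: algebra_simps)
qed

text \<open>Only the summand \<open>i = n\<close> contains the first derivative of the phase, the
  one that vanishes on \<open>\<Gamma>_T\<close>.\<close>

lemma E_d_Suc:
  "E_d x t (Suc n) = (\<Sum>i=0..n. of_nat (n choose i) * E_d x t i
     * (\<i> * ((if n - i = 0 then of_real x else 0) + \<nu>_d (Suc (n - i)) * of_real t)))"
  unfolding E_d_def E_def[abs_def]
    higher_deriv_exp_compose[OF E_phase_holomorphic open_regular \<chi>\<^sub>0_regular] E_phase_deriv ..

text \<open>Bell polynomials with vanishing first argument: only set partitions into blocks of size
  at least 2 count, hence at most two blocks up to order five. The factors 3 and 10 count the
  partitions of types 2+2 and 2+3; the minus sign is the square of \<open>\<i>\<close>.\<close>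

lemma E_d_\<Gamma>_T:
  assumes "(x, t) \<in> \<Gamma>_T"
  shows "E_d x t 0 = E x t \<chi>\<^sub>0"
    "E_d x t 1 = 0"
    "E_d x t 2 = E x t \<chi>\<^sub>0 * (\<i> * \<nu>_d 2 * of_real t)"
    "E_d x t 3 = E x t \<chi>\<^sub>0 * (\<i> * \<nu>_d 3 * of_real t)"
    "E_d x t 4 = E x t \<chi>\<^sub>0 * (\<i> * \<nu>_d 4 * of_real t - 3 * (\<nu>_d 2)\<^sup>2 * (of_real t)\<^sup>2)"
    "E_d x t 5 = E x t \<chi>\<^sub>0 * (\<i> * \<nu>_d 5 * of_real t - 10 * \<nu>_d 2 * \<nu>_d 3 * (of_real t)\<^sup>2)"
proof -
  have "complex_of_real x + \<nu>_d 1 * of_real t = of_real (x + t / (3 * k\<^sup>2))"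
    unfolding \<nu>_d_1 by simp
  also have "x + t / (3 * k\<^sup>2) = 0"
    using assms by (simp add: \<Gamma>_T_def)
  finally have line: "complex_of_real x + \<nu>_d 1 * of_real t = 0"
    by simp
  show E0: "E_d x t 0 = E x t \<chi>\<^sub>0"
    by (simp add: E_d_def)
  show E1: "E_d x t 1 = 0"
    using E_d_Suc[of x t 0] line by simp
  show E2: "E_d x t 2 = E x t \<chi>\<^sub>0 * (\<i> * \<nu>_d 2 * of_real t)"
    using E_d_Suc[of x t 1] line E0 E1 by (simp add: eval_nat_numeral)
  show E3: "E_d x t 3 = E x t \<chi>\<^sub>0 * (\<i> * \<nu>_d 3 * of_real t)"
    using E_d_Suc[of x t 2] line E0 E1 by (simp add: eval_nat_numeral)
  show E4: "E_d x t 4 = E x t \<chi>\<^sub>0 * (\<i> * \<nu>_d 4 * of_real t - 3 * (\<nu>_d 2)\<^sup>2 * (of_real t)\<^sup>2)"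
    using E_d_Suc[of x t 3] line E0 E1 E2 E3
    by (simp add: eval_nat_numeral) (simp add: algebra_simps)
  show "E_d x t 5 = E x t \<chi>\<^sub>0 * (\<i> * \<nu>_d 5 * of_real t - 10 * \<nu>_d 2 * \<nu>_d 3 * (of_real t)\<^sup>2)"
    using E_d_Suc[of x t 4] line E0 E1 E2 E3 E4
    by (simp add: eval_nat_numeral) (simp add: algebra_simps)
qed

lemma Y_component:
  "Y x t n $ i = carrier_wave x t i * (\<Sum>l=0..n. of_nat (n choose l) * v l $ i * E_d x t (n - l))"
proof -
  \<comment> \<open>Component \<open>i\<close> without carrier wave and \<open>E\<close>. Its
    derivatives at the root are the entries of \<open>v\<close>; the constant in component 1
    explains the zeros there.\<close>
  define w where "w = (\<lambda>z. if i = 1 then lam\<^sub>0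
    else if i = 2 then of_real (a 1) * h 1 z else of_real (a 2) * h 2 z)"
  have w_hol: "w holomorphic_on regular"
    unfolding w_def using h_holomorphic exhaust_3[of i] by (auto intro!: holomorphic_intros)
  have w_deriv: "(deriv ^^ l) w \<chi>\<^sub>0 = v l $ i" for l
    using exhaust_3[of i] higher_deriv_cmult[OF h_holomorphic \<chi>\<^sub>0_regular open_regular]
    by (auto simp: w_def v_def h_d_def)
  have "(\<lambda>z. y x t z lam\<^sub>0 $ i) = (\<lambda>z. carrier_wave x t i * (w z * E x t z))"
    using exhaust_3[of i] by (auto simp: y_def u0_def w_def carrier_wave_def mult_ac)
  then have "Y x t n $ i = (deriv ^^ n) (\<lambda>z. carrier_wave x t i * (w z * E x t z)) \<chi>\<^sub>0"
    by (simp add: Y_def)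
  also have "\<dots> = carrier_wave x t i * (deriv ^^ n) (\<lambda>z. w z * E x t z) \<chi>\<^sub>0"
    using w_hol E_holomorphic \<chi>\<^sub>0_regular open_regular
    by (intro higher_deriv_cmult[where A = regular]) (auto intro!: holomorphic_intros)
  also have "(deriv ^^ n) (\<lambda>z. w z * E x t z) \<chi>\<^sub>0
      = (\<Sum>l=0..n. of_nat (n choose l) * v l $ i * E_d x t (n - l))"
    by (simp add: higher_deriv_mult[OF w_hol E_holomorphic open_regular \<chi>\<^sub>0_regular] w_deriv E_d_def)
  finally show ?thesis .
qed

text \<open>Leibniz coefficients times the values of \<open>E_d\<close>; for instance 15 is
  \<open>5 choose 1\<close> times the 3 in \<open>E_d x t 4\<close>. Terms with
  \<open>E_d x t 1\<close> drop out.\<close>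

lemma Y_\<Gamma>_T:
  assumes "(x, t) \<in> \<Gamma>_T"
  defines "\<tau> \<equiv> complex_of_real t"
  shows "Y x t 0 = dress x t (v 0)"
    "Y x t 1 = dress x t (v 1)"
    "Y x t 2 = dress x t (v 2 + (\<i> * \<nu>_d 2 * \<tau>) *s v 0)"
    "Y x t 3 = dress x t (v 3 + (\<i> * \<nu>_d 3 * \<tau>) *s v 0 + (3 * \<i> * \<nu>_d 2 * \<tau>) *s v 1)"
    "Y x t 4 = dress x t (v 4 + (\<i> * \<nu>_d 4 * \<tau> - 3 * (\<nu>_d 2)\<^sup>2 * \<tau>\<^sup>2) *s v 0
       + (4 * \<i> * \<nu>_d 3 * \<tau>) *s v 1 + (6 * \<i> * \<nu>_d 2 * \<tau>) *s v 2)"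
    "Y x t 5 = dress x t (v 5 + (\<i> * \<nu>_d 5 * \<tau> - 10 * \<nu>_d 2 * \<nu>_d 3 * \<tau>\<^sup>2) *s v 0
       + (5 * \<i> * \<nu>_d 4 * \<tau> - 15 * (\<nu>_d 2)\<^sup>2 * \<tau>\<^sup>2) *s v 1
       + (10 * \<i> * \<nu>_d 3 * \<tau>) *s v 2 + (10 * \<i> * \<nu>_d 2 * \<tau>) *s v 3)"
  using E_d_\<Gamma>_T[OF assms(1)] unfolding \<tau>_def
  by (simp_all add: vec_eq_iff Y_component dress_def eval_nat_numeral del: v_components)
    (simp_all add: algebra_simps)

section \<open>\<open>y_R\<close> and \<open>y_\<mu>\<close> as polynomials in
  \<open>t\<close>\<close>

lemma y_R_\<Gamma>_T:
  assumes "(x, t) \<in> \<Gamma>_T"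
  shows "y_R x t = dress x t (r_T + (c_T * of_real t) *s v 0)"
  unfolding y_R_def Y_\<Gamma>_T[OF assms] r_T_def c_T_def
  by (simp add: dress_def vec_eq_iff algebra_simps)

text \<open>The constant term of \<open>y_\<mu>\<close> on \<open>\<Gamma>_T\<close>. It enters
  \<open>m_R\<close> only below the order \<open>t\<^sup>2\<close>.\<close>

definition p_T0 :: "complex ^ 3" where
  "p_T0 = (1 / (2 * lam\<^sub>0)) *s vector [1, 0, 0]
     + (M\<^sub>3 / 6) *s v 3 + (M\<^sub>4 / 24) *s v 4 + (M\<^sub>5 / 120) *s v 5"

lemma y_\<mu>_\<Gamma>_T:
  assumes "(x, t) \<in> \<Gamma>_T"
  shows "y_\<mu> x t = dress x t ((of_real t)\<^sup>2 *s p_T2 + of_real t *s p_T1 + p_T0)"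
proof -
  define e where "e = (1 / (2 * lam\<^sub>0)) *s (vector [1, 0, 0] :: complex ^ 3)"
  \<comment> \<open>The derivative of \<open>lam\<^sub>0\<close> lives in component 1 alone, where
    the carrier wave is 1, so this summand is dressed as well.\<close>
  have "(1 / (2 * lam\<^sub>0)) *s vector [E_d x t 0 + M\<^sub>1 * E_d x t 1 + M\<^sub>2 / 2 * E_d x t 2, 0, 0]
      = dress x t ((1 + \<i> * \<nu>_d 2 * M\<^sub>2 / 2 * of_real t) *s e)"
    unfolding E_d_\<Gamma>_T[OF assms]
    by (simp add: e_def dress_def vec_eq_iff forall_3 carrier_wave_def algebra_simps add_divide_distrib)
  moreover have "(\<i> * \<nu>_d 2 * M\<^sub>2 / (4 * lam\<^sub>0)) *s (vector [1, 0, 0] :: complex ^ 3)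
      = (\<i> * \<nu>_d 2 * M\<^sub>2 / 2) *s e"
    by (simp add: e_def vec_eq_iff forall_3)
  ultimately show ?thesis
    unfolding y_\<mu>_def Y_\<Gamma>_T[OF assms] p_T2_def p_T1_def p_T0_def e_def[symmetric]
    by (simp add: dress_add[symmetric] dress_scale[symmetric])
      (rule arg_cong[of _ _ "dress x t"], simp add: vec_eq_iff field_simps power2_eq_square)
qed

section \<open>Nonvanishing of the leading coefficients\<close>

lemma \<kappa>\<^sub>0_pos: obtains \<kappa> where "\<kappa>\<^sub>0 = of_real \<kappa>" "\<kappa> > 0"
proof -
  obtain l where l: "lam\<^sub>0 = of_real l" "l > 0"
    using lam\<^sub>0_real by metis
  have "\<kappa>\<^sub>0 = of_real ((cmod (v 0 $ 1))\<^sup>2 + (cmod (v 0 $ 2))\<^sup>2 + (cmod (v 0 $ 3))\<^sup>2)"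
    unfolding \<kappa>\<^sub>0_def bracket_K by (simp only: of_real_add complex_norm_square mult.commute)
  then have "\<kappa>\<^sub>0 = of_real (l\<^sup>2 + (cmod (v 0 $ 2))\<^sup>2 + (cmod (v 0 $ 3))\<^sup>2)"
    using l by simp
  moreover have "l\<^sup>2 + (cmod (v 0 $ 2))\<^sup>2 + (cmod (v 0 $ 3))\<^sup>2 > 0"
    using l(2) by (simp add: add_pos_nonneg)
  ultimately show thesis
    by (rule that)
qed

lemma c_T_nz: "c_T \<noteq> 0"
  using \<nu>_d_2_nz M\<^sub>2_nz by (simp add: c_T_def)

text \<open>The term with \<open>Im \<zeta>_T2\<close> is purely imaginary and cannot cancel the
  strictly negative real part.\<close>

lemma d_T_nz: "d_T \<noteq> 0"
proof -
  obtain l where l: "lam\<^sub>0 = of_real l" "l > 0"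
    using lam\<^sub>0_real by metis
  obtain \<kappa> where \<kappa>: "\<kappa>\<^sub>0 = of_real \<kappa>" "\<kappa> > 0"
    using \<kappa>\<^sub>0_pos by metis
  have "d_T = of_real (- ((cmod c_T)\<^sup>2 * \<kappa> / (2 * l))) - \<i> * of_real (2 * l * Im \<zeta>_T2)"
    unfolding d_T_def l(1) \<kappa>(1) by simp
  then have "Re d_T = - ((cmod c_T)\<^sup>2 * \<kappa> / (2 * l))"
    by (simp only: minus_complex.sel complex.sel Re_complex_of_real Re_i_times Im_complex_of_real)
  also have "\<dots> < 0"
    using c_T_nz l(2) \<kappa>(2) by simp
  finally show ?thesis
    by auto
qed

section \<open>\<open>m_R\<close> and the numerator as quadratic polynomials in
  \<open>t\<close>\<close>

lemma v0_p_T2: "bracket (v 0) J p_T2 = 0"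
proof -
  have "bracket (v 0) J (b *s v 0 + c *s v 1) = b * bracket (v 0) J (v 0) + c * bracket (v 0) J (v 1)"
    for b c by (simp add: bracket_J algebra_simps del: v_components)
  moreover have "p_T2 = (- ((\<nu>_d 2)\<^sup>2 * M\<^sub>4 / 8 + \<nu>_d 2 * \<nu>_d 3 * M\<^sub>5 / 12)) *s v 0
      + (- ((\<nu>_d 2)\<^sup>2 * M\<^sub>5 / 8)) *s v 1"
    by (simp add: p_T2_def vec_eq_iff del: v_components)
  ultimately show ?thesis
    by (simp only: v_orthogonal mult_zero_right add_0_right)
qed

text \<open>An exact polynomial identity, from which both the error bound and the limit can be read
  off.\<close>

lemma m_R_\<Gamma>_T:
  obtains e f where
    "\<And>x t. (x, t) \<in> \<Gamma>_T \<Longrightarrow> m_R x t = d_T * (of_real t)\<^sup>2 + e * of_real t + f"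
proof
  \<comment> \<open>The coefficients of \<open>t\<close> and 1, collected from the two expansions
    below.\<close>
  define e f where
    "e = - 2 * \<i> * lam\<^sub>0 * of_real (Im (cnj c_T * bracket (v 0) J p_T0 + bracket r_T J p_T1))
       - (cnj c_T * bracket (v 0) K r_T + c_T * bracket r_T K (v 0)) / (2 * lam\<^sub>0)"
    and "f = - 2 * \<i> * lam\<^sub>0 * of_real (Im (bracket r_T J p_T0))
       - bracket r_T K r_T / (2 * lam\<^sub>0)"
  fix x t assume on: "(x, t) \<in> \<Gamma>_T"
  define \<tau> where "\<tau> = complex_of_real t"
  define w where "w = r_T + (c_T * \<tau>) *s v 0"
  define p where "p = \<tau>\<^sup>2 *s p_T2 + \<tau> *s p_T1 + p_T0"
  have "cnj \<tau> = \<tau>"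
    by (simp add: \<tau>_def)
  then have "bracket w J p = \<tau> ^ 3 * cnj c_T * bracket (v 0) J p_T2 + \<tau>\<^sup>2 * \<zeta>_T2
      + \<tau> * (cnj c_T * bracket (v 0) J p_T0 + bracket r_T J p_T1) + bracket r_T J p_T0"
    and K: "bracket w K w = cnj c_T * c_T * \<tau>\<^sup>2 * \<kappa>\<^sub>0
      + \<tau> * (cnj c_T * bracket (v 0) K r_T + c_T * bracket r_T K (v 0)) + bracket r_T K r_T"
    by (simp_all add: w_def p_def \<zeta>_T2_def \<kappa>\<^sub>0_def bracket_J bracket_K algebra_simps
        power2_eq_square power3_eq_cube del: v_components)
  then have "bracket w J p = of_real (t\<^sup>2) * \<zeta>_T2
      + of_real t * (cnj c_T * bracket (v 0) J p_T0 + bracket r_T J p_T1) + bracket r_T J p_T0"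
    by (simp add: v0_p_T2 \<tau>_def)
  \<comment> \<open>As \<open>t\<close> is real, the imaginary part is taken coefficient by
    coefficient.\<close>
  then have "Im (bracket w J p) = t\<^sup>2 * Im \<zeta>_T2
      + t * Im (cnj c_T * bracket (v 0) J p_T0 + bracket r_T J p_T1) + Im (bracket r_T J p_T0)"
    by (simp only: plus_complex.sel times_complex.sel Re_complex_of_real Im_complex_of_real
        mult_zero_left add_0_right)
  then have Im: "complex_of_real (Im (bracket w J p)) = \<tau>\<^sup>2 * of_real (Im \<zeta>_T2)
      + \<tau> * of_real (Im (cnj c_T * bracket (v 0) J p_T0 + bracket r_T J p_T1))
      + of_real (Im (bracket r_T J p_T0))"
    by (simp only: of_real_add of_real_mult of_real_power \<tau>_def)
  have "m_R x t = lam\<^sub>0 * (bracket p J w - bracket w J p) - bracket w K w / (2 * lam\<^sub>0)"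
    unfolding m_R_def y_R_\<Gamma>_T[OF on] y_\<mu>_\<Gamma>_T[OF on] bracket_dress w_def p_def \<tau>_def ..
  also have "bracket p J w - bracket w J p = - 2 * \<i> * of_real (Im (bracket w J p))"
    by (subst cnj_bracket_J[symmetric]) (simp add: complex_eq_iff)
  finally show "m_R x t = d_T * (of_real t)\<^sup>2 + e * of_real t + f"
    unfolding Im K d_T_def e_def f_def complex_norm_square \<tau>_def[symmetric]
    by (simp add: algebra_simps add_divide_distrib)
qed

text \<open>Division by \<open>u0\<close> removes the carrier wave and the amplitude, and
  \<open>E\<close> meets its conjugate. What remains is a product of two linear polynomials in
  \<open>t\<close>.\<close>

lemma \<Phi>_R_\<psi>_R_\<Gamma>_T:
  assumes "j \<in> {1, 2}"
  obtains e f where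
    "\<And>x t. (x, t) \<in> \<Gamma>_T \<Longrightarrow> 2 * \<Phi>_R j x t * cnj (\<psi>_R x t) / u0 j x t
       = 2 * of_real ((cmod c_T)\<^sup>2) * lam\<^sub>0 * h j \<chi>\<^sub>0 * (of_real t)\<^sup>2 + e * of_real t + f"
proof
  define i :: 3 where "i = (if j = 1 then 2 else 3)"
  define b where "b = complex_of_real (a j)"
  define e f where "e = 2 * (r_T $ i * cnj c_T * lam\<^sub>0 + c_T * b * h j \<chi>\<^sub>0 * cnj (r_T $ 1)) / b"
    and "f = 2 * r_T $ i * cnj (r_T $ 1) / b"
  have b_nz: "b \<noteq> 0"
    using assms A_pos B_pos amplitude1 amplitude2 by (auto simp: b_def)
  have lam: "cnj lam\<^sub>0 = lam\<^sub>0"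
    using lam\<^sub>0_real by (metis complex_cnj_complex_of_real)
  fix x t assume on: "(x, t) \<in> \<Gamma>_T"
  have u0: "u0 j x t = b * carrier_wave x t i"
    using assms by (auto simp: u0_def carrier_wave_def i_def b_def)
  have \<Phi>: "\<Phi>_R j x t = y_R x t $ i"
    by (simp add: \<Phi>_R_def i_def)
  have v: "v 0 $ i = b * h j \<chi>\<^sub>0"
    using assms by (auto simp: v_def i_def b_def h_d_def)
  have E: "E x t \<chi>\<^sub>0 * cnj (E x t \<chi>\<^sub>0) = 1"
    using complex_norm_square[of "E x t \<chi>\<^sub>0"] by (simp add: norm_E)
  have W: "carrier_wave x t i \<noteq> 0"
    using norm_carrier_wave[of x t i] by auto
  have "2 * \<Phi>_R j x t * cnj (\<psi>_R x t) / u0 j x t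
      = 2 * (carrier_wave x t i * E x t \<chi>\<^sub>0 * (r_T $ i + c_T * of_real t * (b * h j \<chi>\<^sub>0)))
        * cnj (E x t \<chi>\<^sub>0 * (r_T $ 1 + c_T * of_real t * lam\<^sub>0)) / (b * carrier_wave x t i)"
    unfolding u0 \<Phi> \<psi>_R_def y_R_\<Gamma>_T[OF on]
    by (simp add: dress_def v) (simp add: carrier_wave_def)
  also have "\<dots> = 2 * (E x t \<chi>\<^sub>0 * cnj (E x t \<chi>\<^sub>0)) * (r_T $ i + c_T * of_real t * (b * h j \<chi>\<^sub>0))
        * (cnj (r_T $ 1) + cnj c_T * of_real t * lam\<^sub>0) / b"
    using W by (simp add: lam mult_ac)
  also have "\<dots> = 2 * (c_T * cnj c_T) * lam\<^sub>0 * h j \<chi>\<^sub>0 * (of_real t)\<^sup>2 + e * of_real t + f"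
    unfolding E e_def f_def using b_nz by (simp add: field_simps power2_eq_square)
  finally show "2 * \<Phi>_R j x t * cnj (\<psi>_R x t) / u0 j x t
       = 2 * of_real ((cmod c_T)\<^sup>2) * lam\<^sub>0 * h j \<chi>\<^sub>0 * (of_real t)\<^sup>2 + e * of_real t + f"
    by (simp only: complex_norm_square)
qed

section \<open>Asymptotics along \<open>\<Gamma>_T\<close>\<close>

lemma eventually_along_\<Gamma>_TI:
  assumes "\<And>x t. (x, t) \<in> \<Gamma>_T \<Longrightarrow> \<bar>t\<bar> \<ge> b \<Longrightarrow> P (x, t)"
  shows "eventually P along_\<Gamma>_T"
  unfolding along_\<Gamma>_T_def eventually_inf_principal eventually_filtercomap
  using assms by (intro exI[of _ "\<lambda>t. \<bar>t\<bar> \<ge> b"]) (auto simp: eventually_at_infinity)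

text \<open>Needed for uniqueness of limits, without which failure of decay could not be
  inferred.\<close>

lemma along_\<Gamma>_T_nontrivial: "along_\<Gamma>_T \<noteq> bot"
proof
  assume "along_\<Gamma>_T = bot"
  then have "eventually (\<lambda>_. False) along_\<Gamma>_T"
    by simp
  then obtain Q b where Q: "\<And>p. Q (snd p) \<Longrightarrow> p \<notin> \<Gamma>_T" "\<And>t. norm t \<ge> b \<Longrightarrow> Q t"
    unfolding along_\<Gamma>_T_def eventually_inf_principal eventually_filtercomap eventually_at_infinity
    by blast
  \<comment> \<open>A point of the line beyond the threshold; the absolute value covers a negative
    \<open>b\<close>.\<close>
  have "(- \<bar>b\<bar> / (3 * k\<^sup>2), \<bar>b\<bar>) \<in> \<Gamma>_T"
    by (simp add: \<Gamma>_T_def)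
  with Q(1)[of "(- \<bar>b\<bar> / (3 * k\<^sup>2), \<bar>b\<bar>)"] Q(2)[of "\<bar>b\<bar>"] show False
    by simp
qed

lemma inverse_t_tendsto_0: "((\<lambda>p. inverse (complex_of_real (snd p))) \<longlongrightarrow> 0) along_\<Gamma>_T"
proof -
  have "filterlim snd at_infinity along_\<Gamma>_T"
    unfolding along_\<Gamma>_T_def by (rule filterlim_mono[OF filterlim_filtercomap order_refl inf_le1])
  then have "((\<lambda>p. inverse (snd p)) \<longlongrightarrow> 0) along_\<Gamma>_T"
    by (rule filterlim_compose[OF tendsto_inverse_0])
  from tendsto_of_real[OF this, where 'a = complex] show ?thesis
    by simp
qed

lemma quadratic_remainder_bigo:
  fixes g :: "real \<Rightarrow> real \<Rightarrow> complex"
  assumes "\<And>x t. (x, t) \<in> \<Gamma>_T \<Longrightarrow> g x t = d * (of_real t)\<^sup>2 + e * of_real t + f"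
  shows "(\<lambda>(x, t). g x t - d * of_real (t\<^sup>2)) \<in> O[along_\<Gamma>_T](\<lambda>(x, t). of_real \<bar>t\<bar>)"
\<comment> \<open>For \<open>|t| \<ge> 1\<close> the constant term is absorbed into
  \<open>|t|\<close>.\<close>
proof (rule bigoI[where c = "cmod e + cmod f"], rule eventually_along_\<Gamma>_TI[where b = 1])
  fix x t assume on: "(x, t) \<in> \<Gamma>_T" and t: "\<bar>t\<bar> \<ge> 1"
  have "cmod (g x t - d * of_real (t\<^sup>2)) = cmod (e * of_real t + f)"
    by (simp add: assms[OF on])
  also have "\<dots> \<le> cmod e * \<bar>t\<bar> + cmod f"
    by (rule norm_triangle_le) (simp add: norm_mult)
  also have "\<dots> \<le> cmod e * \<bar>t\<bar> + cmod f * \<bar>t\<bar>"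
    using mult_left_mono[OF t, of "cmod f"] by simp
  finally show "cmod (case (x, t) of (x, t) \<Rightarrow> g x t - d * of_real (t\<^sup>2))
      \<le> (cmod e + cmod f) * cmod (case (x, t) of (x, t) \<Rightarrow> of_real \<bar>t\<bar>)"
    by (simp add: algebra_simps)
qed

text \<open>With \<open>1 / t\<close> as small parameter the quotient becomes a rational function
  continuous at 0.\<close>

lemma quadratic_quotient_tendsto:
  fixes g g' :: "real \<Rightarrow> real \<Rightarrow> complex"
  assumes g: "\<And>x t. (x, t) \<in> \<Gamma>_T \<Longrightarrow> g x t = d * (of_real t)\<^sup>2 + e * of_real t + f"
    and g': "\<And>x t. (x, t) \<in> \<Gamma>_T \<Longrightarrow> g' x t = d' * (of_real t)\<^sup>2 + e' * of_real t + f'"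
    and "d' \<noteq> 0"
  shows "((\<lambda>(x, t). g x t / g' x t) \<longlongrightarrow> d / d') along_\<Gamma>_T"
proof -
  define \<epsilon> where "\<epsilon> p = inverse (complex_of_real (snd p))" for p :: "real \<times> real"
  have "(\<epsilon> \<longlongrightarrow> 0) along_\<Gamma>_T"
    unfolding \<epsilon>_def by (rule inverse_t_tendsto_0)
  then have "((\<lambda>p. (d + e * \<epsilon> p + f * (\<epsilon> p)\<^sup>2) / (d' + e' * \<epsilon> p + f' * (\<epsilon> p)\<^sup>2))
      \<longlongrightarrow> (d + e * 0 + f * 0\<^sup>2) / (d' + e' * 0 + f' * 0\<^sup>2)) along_\<Gamma>_T"
    using \<open>d' \<noteq> 0\<close> by (intro tendsto_intros) auto
  moreover have "eventually (\<lambda>p. (d + e * \<epsilon> p + f * (\<epsilon> p)\<^sup>2) / (d' + e' * \<epsilon> p + f' * (\<epsilon> p)\<^sup>2)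
      = (case p of (x, t) \<Rightarrow> g x t / g' x t)) along_\<Gamma>_T"
  \<comment> \<open>The threshold 1 serves only to keep \<open>t\<close> away from 0.\<close>
  proof (rule eventually_along_\<Gamma>_TI[where b = 1])
    fix x t assume on: "(x, t) \<in> \<Gamma>_T" and "\<bar>t\<bar> \<ge> (1::real)"
    then have t: "complex_of_real t \<noteq> 0"
      by auto
    define s where "s = \<epsilon> (x, t)"
    have s: "complex_of_real t = 1 / s" "s \<noteq> 0"
      using t by (simp_all add: s_def \<epsilon>_def field_simps)
    have "g x t = (d + e * s + f * s\<^sup>2) / s\<^sup>2" "g' x t = (d' + e' * s + f' * s\<^sup>2) / s\<^sup>2"
      unfolding g[OF on] g'[OF on] s(1) using s(2) by (simp_all add: field_simps power2_eq_square)
    then show "(d + e * \<epsilon> (x, t) + f * (\<epsilon> (x, t))\<^sup>2) / (d' + e' * \<epsilon> (x, t) + f' * (\<epsilon> (x, t))\<^sup>2)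
      = (case (x, t) of (x, t) \<Rightarrow> g x t / g' x t)"
      using s(2) by (simp add: s_def)
  qed
  ultimately show ?thesis
    by (simp add: tendsto_cong)
qed

lemma m_R_bigo:
  "(\<lambda>(x, t). m_R x t - d_T * of_real (t\<^sup>2)) \<in> O[along_\<Gamma>_T](\<lambda>(x, t). of_real \<bar>t\<bar>)"
  by (rule m_R_\<Gamma>_T, rule quadratic_remainder_bigo)

lemma \<Phi>_R_\<psi>_R_bigo:
  assumes "j \<in> {1, 2}"
  shows "(\<lambda>(x, t). 2 * \<Phi>_R j x t * cnj (\<psi>_R x t) / u0 j x t
      - 2 * of_real ((cmod c_T)\<^sup>2) * lam\<^sub>0 * h j \<chi>\<^sub>0 * of_real (t\<^sup>2))
    \<in> O[along_\<Gamma>_T](\<lambda>(x, t). of_real \<bar>t\<bar>)"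
  by (rule \<Phi>_R_\<psi>_R_\<Gamma>_T[OF assms], rule quadratic_remainder_bigo)

section \<open>The limit of the ratio and the absence of decay\<close>

lemma cmod_u0: "cmod (u0 j x t) = \<bar>a j\<bar>"
  by (simp add: u0_def norm_mult)

lemma a_nz: "j \<in> {1, 2} \<Longrightarrow> a j \<noteq> 0"
  using A_pos B_pos amplitude1 amplitude2 by auto

lemma u_R_ratio_tendsto:
  assumes "j \<in> {1, 2}"
  shows "((\<lambda>(x, t). u_R j x t / u0 j x t) \<longlongrightarrow> P_T j) along_\<Gamma>_T"
proof -
  obtain e f where num: "\<And>x t. (x, t) \<in> \<Gamma>_T \<Longrightarrow> 2 * \<Phi>_R j x t * cnj (\<psi>_R x t) / u0 j x t
       = 2 * of_real ((cmod c_T)\<^sup>2) * lam\<^sub>0 * h j \<chi>\<^sub>0 * (of_real t)\<^sup>2 + e * of_real t + f"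
    using \<Phi>_R_\<psi>_R_\<Gamma>_T[OF assms] by blast
  obtain e' f' where den:
    "\<And>x t. (x, t) \<in> \<Gamma>_T \<Longrightarrow> m_R x t = d_T * (of_real t)\<^sup>2 + e' * of_real t + f'"
    using m_R_\<Gamma>_T by blast
  have "u_R j x t / u0 j x t = 1 + 2 * \<Phi>_R j x t * cnj (\<psi>_R x t) / u0 j x t / m_R x t" for x t
  proof -
    have "u0 j x t \<noteq> 0"
      using cmod_u0[of j x t] a_nz[OF assms] by auto
    then show ?thesis
      by (simp add: u_R_def add_divide_distrib mult_ac)
  qed
  then have "(\<lambda>(x, t). u_R j x t / u0 j x t)
      = (\<lambda>p. 1 + (case p of (x, t) \<Rightarrow> 2 * \<Phi>_R j x t * cnj (\<psi>_R x t) / u0 j x t / m_R x t))"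
    by auto
  then show ?thesis
    unfolding P_T_def
    using tendsto_add[OF tendsto_const quadratic_quotient_tendsto[OF num den d_T_nz]] by simp
qed

lemma P_T_neq_1: "P_T j \<noteq> 1"
proof -
  have "lam\<^sub>0 \<noteq> 0"
    using lam\<^sub>0_real by (metis less_irrefl of_real_eq_0_iff)
  then show ?thesis
    using c_T_nz d_T_nz h_\<chi>\<^sub>0_nz by (simp add: P_T_def)
qed

text \<open>The background has constant modulus, so a vanishing difference would drive the ratio to
  1, whereas its limit \<open>P_T j\<close> differs from 1.\<close>

lemma u_R_not_decaying:
  assumes "j \<in> {1, 2}"
  shows "\<not> ((\<lambda>(x, t). u_R j x t - u0 j x t) \<longlongrightarrow> 0) along_\<Gamma>_T"
proof
  assume "((\<lambda>(x, t). u_R j x t - u0 j x t) \<longlongrightarrow> 0) along_\<Gamma>_T"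
  then have "((\<lambda>p. cmod (case p of (x, t) \<Rightarrow> u_R j x t - u0 j x t) / \<bar>a j\<bar>) \<longlongrightarrow> 0 / \<bar>a j\<bar>) along_\<Gamma>_T"
    using a_nz[OF assms] by (intro tendsto_divide tendsto_const tendsto_norm_zero) auto
  moreover have "cmod (u_R j x t - u0 j x t) / \<bar>a j\<bar> = cmod (u_R j x t / u0 j x t - 1)" for x t
  proof -
    have "u0 j x t \<noteq> 0"
      using cmod_u0[of j x t] a_nz[OF assms] by auto
    then have "u_R j x t / u0 j x t - 1 = (u_R j x t - u0 j x t) / u0 j x t"
      by (simp add: diff_divide_distrib)
    then show ?thesis
      by (simp add: norm_divide cmod_u0)
  qed
  ultimately have "((\<lambda>p. cmod ((case p of (x, t) \<Rightarrow> u_R j x t / u0 j x t) - 1)) \<longlongrightarrow> 0) along_\<Gamma>_T"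
    by (simp add: case_prod_beta)
  moreover have "((\<lambda>p. cmod ((case p of (x, t) \<Rightarrow> u_R j x t / u0 j x t) - 1))
      \<longlongrightarrow> cmod (P_T j - 1)) along_\<Gamma>_T"
    by (intro tendsto_intros u_R_ratio_tendsto assms)
  ultimately have "cmod (P_T j - 1) = 0"
    using tendsto_unique along_\<Gamma>_T_nontrivial by blast
  then show False
    using P_T_neq_1 by simp
qed

end

text \<open>The triple root enters as an identity over the complex numbers; that the root and
  \<open>\<mu>\<^sub>0\<close> are real is derived. The constraint is imposed at a single arbitrary
  point, and the last conjunct expresses the absence of decay.\<close>

theorem proposition42:
  fixes A B k x\<^sub>0 t\<^sub>0 :: real and a :: "nat \<Rightarrow> real"
    and \<chi>\<^sub>0 \<mu>\<^sub>0 M\<^sub>1 M\<^sub>2 :: complex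
  assumes "A > 0" and "B > 0" and "k \<noteq> 0"
    and "(a 1)\<^sup>2 = A" and "(a 2)\<^sup>2 = B"
    and triple_root: "\<And>z. triple_data.F A B k z \<mu>\<^sub>0 = \<mu>\<^sub>0 * (z - \<chi>\<^sub>0) ^ 3"
    and "M\<^sub>2 \<noteq> 0"
    and constraint:
      "triple_data.gram A B k a \<chi>\<^sub>0 \<mu>\<^sub>0 x\<^sub>0 t\<^sub>0 1 1 * of_real ((cmod M\<^sub>1)\<^sup>2)
       + triple_data.gram A B k a \<chi>\<^sub>0 \<mu>\<^sub>0 x\<^sub>0 t\<^sub>0 0 2 * of_real (Re M\<^sub>2)
       + of_real (Re (triple_data.gram A B k a \<chi>\<^sub>0 \<mu>\<^sub>0 x\<^sub>0 t\<^sub>0 1 2 * cnj M\<^sub>1 * M\<^sub>2))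
       + triple_data.gram A B k a \<chi>\<^sub>0 \<mu>\<^sub>0 x\<^sub>0 t\<^sub>0 2 2 / 4 * of_real ((cmod M\<^sub>2)\<^sup>2) = 0"
  shows "(\<lambda>(x, t). triple_data.m_R A B k a \<chi>\<^sub>0 \<mu>\<^sub>0 M\<^sub>1 M\<^sub>2 x t
             - triple_data.d_T A B k a \<chi>\<^sub>0 \<mu>\<^sub>0 M\<^sub>1 M\<^sub>2 * of_real (t\<^sup>2))
           \<in> O[triple_data.along_\<Gamma>_T k](\<lambda>(x, t). of_real \<bar>t\<bar>)
       \<and> (\<forall>j\<in>{1, 2}.
           (\<lambda>(x, t). 2 * triple_data.\<Phi>_R A B k a \<chi>\<^sub>0 \<mu>\<^sub>0 M\<^sub>1 M\<^sub>2 j x t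
                        * cnj (triple_data.\<psi>_R A B k a \<chi>\<^sub>0 \<mu>\<^sub>0 M\<^sub>1 M\<^sub>2 x t)
                        / triple_data.u0 A B k a j x t
               - 2 * of_real ((cmod (triple_data.c_T A B k \<chi>\<^sub>0 M\<^sub>2))\<^sup>2) * triple_data.lam\<^sub>0 \<mu>\<^sub>0
                   * triple_data.h k j \<chi>\<^sub>0 * of_real (t\<^sup>2))
             \<in> O[triple_data.along_\<Gamma>_T k](\<lambda>(x, t). of_real \<bar>t\<bar>)
         \<and> ((\<lambda>(x, t). triple_data.u_R A B k a \<chi>\<^sub>0 \<mu>\<^sub>0 M\<^sub>1 M\<^sub>2 j x t
                         / triple_data.u0 A B k a j x t)
              \<longlongrightarrow> triple_data.P_T A B k a \<chi>\<^sub>0 \<mu>\<^sub>0 M\<^sub>1 M\<^sub>2 j) (triple_data.along_\<Gamma>_T k)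
         \<and> triple_data.P_T A B k a \<chi>\<^sub>0 \<mu>\<^sub>0 M\<^sub>1 M\<^sub>2 j \<noteq> 1
         \<and> \<not> ((\<lambda>(x, t). triple_data.u_R A B k a \<chi>\<^sub>0 \<mu>\<^sub>0 M\<^sub>1 M\<^sub>2 j x t
                            - triple_data.u0 A B k a j x t)
                 \<longlongrightarrow> 0) (triple_data.along_\<Gamma>_T k))"
proof -
  interpret triple_root A B k a \<chi>\<^sub>0 \<mu>\<^sub>0 M\<^sub>1 M\<^sub>2
    using assms by unfold_locales auto
  show ?thesis
    by (intro conjI ballI m_R_bigo \<Phi>_R_\<psi>_R_bigo u_R_ratio_tendsto P_T_neq_1 u_R_not_decaying)
qed

end
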